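(* Let $M,N\in\mathbb{S}^n$. Suppose that $N$ is indefinite and that $x^\top Mx\geqslant 0$ for all $x\in\mathbb{R}^{n}$ with $x^\top Nx=0$. Then $\ker N\cap \{\xi\in\mathbb{R}^n\mid \xi^\top M\xi=0\}\subset \ker M$.
   Context: $\mathbb{S}^n$ denotes the set of real symmetric $n\times n$ matrices. A matrix $N\in\mathbb{S}^n$ is indefinite if it is neither positive semi-definite nor negative semi-definite, i.e., there exist $u,v\in\mathbb{R}^n$ with $u^\top Nu>0$ and $v^\top Nv<0$. For a matrix $A\in\mathbb{R}^{n\times m}$, $\ker A=\{x\in\mathbb{R}^{m}\mid Ax=0\}$. The symbol $\subset$ denotes (not necessarily proper) set inclusion. *)

theory Defs
  imports "HOL-Analysis.Analysis"
begin

definition sym_matrices :: "(real ^ 'n ^ 'n) set" where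
  "sym_matrices = {A. transpose A = A}"

(* The three notions below do not include symmetry of the matrix;
   it is meant to be assumed separately via sym_matrices. *)

definition pos_semidef :: "real ^ 'n ^ 'n \<Rightarrow> bool" where
  "pos_semidef A \<longleftrightarrow> (\<forall>x. x \<bullet> (A *v x) \<ge> 0)"

definition neg_semidef :: "real ^ 'n ^ 'n \<Rightarrow> bool" where
  "neg_semidef A \<longleftrightarrow> (\<forall>x. x \<bullet> (A *v x) \<le> 0)"

definition indefinite :: "real ^ 'n ^ 'n \<Rightarrow> bool" where
  "indefinite A \<longleftrightarrow> \<not> pos_semidef A \<and> \<not> neg_semidef A"

definition mat_ker :: "real ^ 'm ^ 'n \<Rightarrow> (real ^ 'm) set" where
  "mat_ker A = {x. A *v x = 0}"

end

theory Submission
  imports Defs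
begin

text \<open>
  Write \<open>q\<^sub>M x = x \<bullet> (M *v x)\<close>, and let \<open>\<xi>\<close> lie in the kernel of \<open>N\<close> with \<open>q\<^sub>M \<xi> = 0\<close>.
  Translating by \<open>t \<xi>\<close> leaves \<open>q\<^sub>N\<close> unchanged, so if \<open>q\<^sub>N x = 0\<close> then \<open>q\<^sub>M\<close> is nonnegative on
  the whole line \<open>x + t \<xi>\<close>. There \<open>q\<^sub>M\<close> is affine in \<open>t\<close> with slope \<open>2 (x \<bullet> M \<xi>)\<close>, and an affine
  function bounded below is constant. Hence \<open>M \<xi>\<close> is orthogonal to every null vector of \<open>q\<^sub>N\<close>.

  It remains to see that the null vectors of the indefinite form \<open>q\<^sub>N\<close> span the whole space, which
  is lemma \<open>orthogonal_null_vectors_imp_orthogonal\<close>: through a vector \<open>w\<close> with \<open>q\<^sub>N w \<noteq> 0\<close> runs a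
  line whose direction has the opposite sign, and this line meets the null cone in two distinct
  points, of which \<open>w\<close> is an affine combination.
\<close>

lemma symmetric_form_add_scaleR:
  fixes A :: "real ^ 'n ^ 'n"
  assumes "A \<in> sym_matrices"
  shows "(x + t *\<^sub>R y) \<bullet> (A *v (x + t *\<^sub>R y))
    = x \<bullet> (A *v x) + 2 * t * (x \<bullet> (A *v y)) + t\<^sup>2 * (y \<bullet> (A *v y))"
proof -
  have "y \<bullet> (A *v x) = x \<bullet> (A *v y)"
    using assms dot_lmul_matrix[of y A x] transpose_matrix_vector[of A y]
    by (simp add: sym_matrices_def inner_commute)
  then show ?thesis
    by (simp add: matrix_vector_right_distrib matrix_vector_mult_scaleR inner_add_left
        inner_add_right power2_eq_square distrib_left)
qed

lemma affine_nonneg_imp_slope_zero: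
  fixes a b :: real
  assumes "\<And>t. 0 \<le> a + t * b"
  shows "b = 0"
proof (rule ccontr)
  assume "b \<noteq> 0"
  then show False
    using assms[of "- (a + 1) / b"] by simp
qed

text \<open>The quarter discriminant satisfies \<open>b\<^sup>2 - c * d \<ge> - c * d > 0\<close>.\<close>

lemma quadratic_two_roots_if_opposite_signs:
  fixes b c d :: real
  assumes "c * d < 0"
  obtains r s where "r \<noteq> s" "c + 2 * r * b + r\<^sup>2 * d = 0" "c + 2 * s * b + s\<^sup>2 * d = 0"
proof -
  define e where "e = sqrt (b\<^sup>2 - c * d)"
  have "b\<^sup>2 - c * d > 0"
    using assms zero_le_power2[of b] by linarith
  then have e: "e > 0" "e\<^sup>2 = b\<^sup>2 - c * d"
    by (simp_all add: e_def)
  have d: "d \<noteq> 0"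
    using assms by auto
  have root: "c + 2 * ((f - b) / d) * b + ((f - b) / d)\<^sup>2 * d = 0" if "f\<^sup>2 = b\<^sup>2 - c * d" for f
  proof -
    have "d * (c + 2 * ((f - b) / d) * b + ((f - b) / d)\<^sup>2 * d) = c * d + f\<^sup>2 - b\<^sup>2"
      using d by (simp add: field_simps power2_eq_square)
    then show ?thesis
      using that d by simp
  qed
  show ?thesis
  proof
    show "(e - b) / d \<noteq> (- e - b) / d"
      using e d by simp
  qed (use root[of e] root[of "- e"] e in simp_all)
qed

text \<open>
  On a line \<open>w + t z\<close> whose direction \<open>z\<close> has the sign opposite to that of \<open>w\<close>, the form is a
  quadratic polynomial in \<open>t\<close> with two distinct roots. The affine function
  \<open>t \<mapsto> (w + t z) \<bullet> p\<close> vanishes at both, hence also at \<open>t = 0\<close>.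
\<close>

lemma orthogonal_null_vectors_imp_orthogonal_if_opposite_signs:
  fixes A :: "real ^ 'n ^ 'n"
  assumes sym: "A \<in> sym_matrices"
    and opposite: "(w \<bullet> (A *v w)) * (z \<bullet> (A *v z)) < 0"
    and null: "\<And>x. x \<bullet> (A *v x) = 0 \<Longrightarrow> x \<bullet> p = 0"
  shows "w \<bullet> p = 0"
proof -
  obtain r s where rs: "r \<noteq> s"
    "w \<bullet> (A *v w) + 2 * r * (w \<bullet> (A *v z)) + r\<^sup>2 * (z \<bullet> (A *v z)) = 0"
    "w \<bullet> (A *v w) + 2 * s * (w \<bullet> (A *v z)) + s\<^sup>2 * (z \<bullet> (A *v z)) = 0"
    using quadratic_two_roots_if_opposite_signs[OF opposite] by metis
  have "(w + r *\<^sub>R z) \<bullet> p = 0" "(w + s *\<^sub>R z) \<bullet> p = 0"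
    using rs by (auto intro!: null simp: symmetric_form_add_scaleR[OF sym])
  then have r: "w \<bullet> p + r * (z \<bullet> p) = 0" and s: "w \<bullet> p + s * (z \<bullet> p) = 0"
    by (simp_all add: inner_add_left)
  then have "r * (z \<bullet> p) = s * (z \<bullet> p)"
    by linarith
  then have "z \<bullet> p = 0"
    using rs(1) by simp
  then show ?thesis
    using r by simp
qed

text \<open>
  In other words, the null vectors of an indefinite form span the space. Indefiniteness supplies a
  direction of either sign, so every vector that is not null has one of the opposite sign at hand.
\<close>

lemma orthogonal_null_vectors_imp_orthogonal:
  fixes A :: "real ^ 'n ^ 'n"
  assumes sym: "A \<in> sym_matrices" and indef: "indefinite A"
    and null: "\<And>x. x \<bullet> (A *v x) = 0 \<Longrightarrow> x \<bullet> p = 0"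
  shows "w \<bullet> p = 0"
proof -
  obtain u v where uv: "u \<bullet> (A *v u) > 0" "v \<bullet> (A *v v) < 0"
    using indef by (auto simp: indefinite_def pos_semidef_def neg_semidef_def not_le)
  consider "w \<bullet> (A *v w) = 0" | "w \<bullet> (A *v w) > 0" | "w \<bullet> (A *v w) < 0"
    by linarith
  then show ?thesis
  proof cases
    case 1
    then show ?thesis by (rule null)
  next
    case 2
    then have "(w \<bullet> (A *v w)) * (v \<bullet> (A *v v)) < 0"
      using uv by (simp add: mult_pos_neg)
    then show ?thesis
      using orthogonal_null_vectors_imp_orthogonal_if_opposite_signs[OF sym _ null] by blast
  next
    case 3
    then have "(w \<bullet> (A *v w)) * (u \<bullet> (A *v u)) < 0"
      using uv by (simp add: mult_neg_pos)
    then show ?thesis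
      using orthogonal_null_vectors_imp_orthogonal_if_opposite_signs[OF sym _ null] by blast
  qed
qed

theorem proposition2:
  fixes M N :: "real ^ 'n ^ 'n"
  assumes "M \<in> sym_matrices" and "N \<in> sym_matrices"
    and "indefinite N"
    and "\<And>x :: real ^ 'n. x \<bullet> (N *v x) = 0 \<Longrightarrow> x \<bullet> (M *v x) \<ge> 0"
  shows "mat_ker N \<inter> {\<xi> :: real ^ 'n. \<xi> \<bullet> (M *v \<xi>) = 0} \<subseteq> mat_ker M"
proof
  fix \<xi> :: "real ^ 'n"
  assume "\<xi> \<in> mat_ker N \<inter> {\<xi>. \<xi> \<bullet> (M *v \<xi>) = 0}"
  then have N\<xi>: "N *v \<xi> = 0" and M\<xi>: "\<xi> \<bullet> (M *v \<xi>) = 0"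
    by (auto simp: mat_ker_def)
  have null: "x \<bullet> (M *v \<xi>) = 0" if x: "x \<bullet> (N *v x) = 0" for x
  proof -
    have "0 \<le> x \<bullet> (M *v x) + t * (2 * (x \<bullet> (M *v \<xi>)))" for t
    proof -
      have "(x + t *\<^sub>R \<xi>) \<bullet> (N *v (x + t *\<^sub>R \<xi>)) = 0"
        by (simp add: symmetric_form_add_scaleR[OF assms(2)] x N\<xi>)
      then have "0 \<le> (x + t *\<^sub>R \<xi>) \<bullet> (M *v (x + t *\<^sub>R \<xi>))"
        by (rule assms(4))
      then show ?thesis
        by (simp add: symmetric_form_add_scaleR[OF assms(1)] M\<xi> mult.commute mult.left_commute)
    qed
    then have "2 * (x \<bullet> (M *v \<xi>)) = 0"
      by (rule affine_nonneg_imp_slope_zero)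
    then show ?thesis by simp
  qed
  have "(M *v \<xi>) \<bullet> (M *v \<xi>) = 0"
    using orthogonal_null_vectors_imp_orthogonal[OF assms(2,3) null] .
  then show "\<xi> \<in> mat_ker M"
    by (simp add: mat_ker_def)
qed

end
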